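(* Let $A\in\mathbb{R}^{m\times n}$ and $(\bar b,\bar\lambda)\in\mathbb{R}^m\times\mathbb{R}_{++}$. Let $S(b,\lambda):=\mathrm{argmin}_{x\in\mathbb{R}^n}\{\|Ax-b\|+\lambda\|x\|_1\}$ be the solution mapping of the SR-LASSO problem. Suppose that $\{Ax:x\in S(\bar b,\bar\lambda)\}\ne\{\bar b\}$. Then $S$ is locally single-valued and Lipschitz at $(\bar b,\bar\lambda)$ if and only if there is a minimizer $\bar x\in S(\bar b,\bar\lambda)$ with $A\bar x\ne\bar b$, $\ker(A_{J_{SR}})=\{0\}$ and $\bar b\notin\mathrm{rge}(A_{J_{SR}})$, where $$J_{SR}=J_{SR}(\bar x):=\left\{i\in[n]:\left|A_i^T\frac{\bar b-A\bar x}{\|A\bar x-\bar b\|}\right|=\bar\lambda\right\}.$$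
   Context: $\mathbb{R}_{++}=(0,\infty)$, $[n]=\{1,\dots,n\}$; $\|\cdot\|$ is the Euclidean norm and $\|\cdot\|_1$ the $\ell_1$-norm. $A_i$ is the $i$-th column of $A$; for $I\subset[n]$, $A_I$ is the submatrix of columns of $A$ indexed by $I$, with range $\mathrm{rge}(A_I)$; for $I=\emptyset$ both the range and the kernel are $\{0\}$. "Locally single-valued and Lipschitz at $(\bar b,\bar\lambda)$" means that there is a neighborhood of $(\bar b,\bar\lambda)$ on which $S(b,\lambda)$ is a singleton and, as a function, $S$ is Lipschitz continuous. *)

theory Defs
  imports "HOL-Analysis.Analysis"
begin

definition l1_norm :: "real ^ 'n \<Rightarrow> real" where
  "l1_norm x = (\<Sum>i\<in>UNIV. \<bar>x $ i\<bar>)"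

definition sr_lasso_obj ::
    "real ^ 'n ^ 'm \<Rightarrow> real ^ 'm \<Rightarrow> real \<Rightarrow> real ^ 'n \<Rightarrow> real" where
  "sr_lasso_obj A b lam x = norm (A *v x - b) + lam * l1_norm x"

definition sr_lasso_sol ::
    "real ^ 'n ^ 'm \<Rightarrow> (real ^ 'm) \<times> real \<Rightarrow> (real ^ 'n) set" where
  "sr_lasso_sol A = (\<lambda>(b, lam). {x. is_arg_min (sr_lasso_obj A b lam) (\<lambda>_. True) x})"

text \<open>A coefficient vector for the column submatrix \<open>A\<^sub>I\<close>, i.e. an element of
  \<open>\<real>\<^sup>I\<close>, is represented by its extension by zero to all of the index type.
  For \<open>I = {}\<close> the space of coefficient vectors, and hence both the kernel and the
  range, is \<open>{0}\<close>.\<close>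

definition coeff_space :: "'n set \<Rightarrow> (real ^ 'n) set" where
  "coeff_space I = {z. \<forall>i. i \<notin> I \<longrightarrow> z $ i = 0}"

definition submatrix_mult ::
    "real ^ 'n ^ 'm \<Rightarrow> 'n set \<Rightarrow> real ^ 'n \<Rightarrow> real ^ 'm" where
  "submatrix_mult A I z = (\<Sum>i\<in>I. z $ i *\<^sub>R column i A)"

definition submatrix_ker :: "real ^ 'n ^ 'm \<Rightarrow> 'n set \<Rightarrow> (real ^ 'n) set" where
  "submatrix_ker A I = {z \<in> coeff_space I. submatrix_mult A I z = 0}"

definition submatrix_rge :: "real ^ 'n ^ 'm \<Rightarrow> 'n set \<Rightarrow> (real ^ 'm) set" where
  "submatrix_rge A I = submatrix_mult A I ` coeff_space I"

text \<open>Only meaningful when \<open>A *v x \<noteq> b\<close>.\<close>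

definition J_SR ::
    "real ^ 'n ^ 'm \<Rightarrow> real ^ 'm \<Rightarrow> real \<Rightarrow> real ^ 'n \<Rightarrow> 'n set" where
  "J_SR A b lam x =
     {i. \<bar>column i A \<bullet> ((b - A *v x) /\<^sub>R norm (A *v x - b))\<bar> = lam}"

text \<open>\<open>D\<close> is the domain on which the set-valued map \<open>T\<close> is considered; the
  neighbourhood of \<open>p\<close> is required to lie inside it.\<close>

definition locally_single_valued_lipschitz ::
    "'a::metric_space set \<Rightarrow> ('a \<Rightarrow> 'b::metric_space set) \<Rightarrow> 'a \<Rightarrow> bool" where
  "locally_single_valued_lipschitz D T p \<longleftrightarrow>
     (\<exists>U. open U \<and> p \<in> U \<and> U \<subseteq> D \<and> (\<forall>q\<in>U. is_singleton (T q)) \<and>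
          (\<exists>L. L-lipschitz_on U (\<lambda>q. the_elem (T q))))"

end

theory Submission
  imports Defs
begin

text \<open>
  Everything is read off from dual certificates. If \<open>A x \<noteq> b\<close>, then \<open>x\<close> minimizes the objective
  iff the unit residual \<open>r = (b - A x) / \<parallel>b - A x\<parallel>\<close> satisfies \<open>\<bar>A\<^sub>i \<bullet> r\<bar> \<le> \<lambda>\<close> for all \<open>i\<close>, with
  \<open>A\<^sub>i \<bullet> r = \<lambda> sgn x\<^sub>i\<close> on the support of \<open>x\<close>. In particular the support lies in
  \<open>J = {i. \<bar>A\<^sub>i \<bullet> r\<bar> = \<lambda>}\<close>, and for that reason the two conditions on \<open>J\<close> together say precisely that
  the linear map \<open>(z, \<tau>) \<mapsto> A z + \<tau> r\<close> is injective on \<open>\<real>\<^sup>J \<times> \<real>\<close> (\<open>submatrix_conditions_iff\<close>).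

  Necessity. Enlarge the support of \<open>x\<close> until it fills \<open>J\<close>: let \<open>w\<close> carry the signs of
  \<open>A\<^sub>i \<bullet> r\<close> on \<open>J\<close> and vanish elsewhere, and replace \<open>(x, b)\<close> by \<open>(x + \<epsilon> w, b + \<epsilon> A w)\<close>. The residual
  does not change, so \<open>r\<close> still certifies optimality, but now the support is all of \<open>J\<close>. If
  \<open>A z + \<tau> r = 0\<close> with \<open>z \<noteq> 0\<close> supported in \<open>J\<close>, then moving a little along \<open>z\<close> keeps the signs and
  keeps the residual on the ray through \<open>r\<close>, which yields a second minimizer. Thus already
  single-valuedness fails arbitrarily close to \<open>b\<close>, with the same \<open>\<lambda>\<close>.

  Sufficiency. A certificate for one minimizer certifies all of them, so injectivity gives a unique
  minimizer. By compactness, the minimizers for nearby data are then close to it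
  (\<open>sr_lasso_sol_upper_semicontinuous\<close>), hence have nonzero residual, unit residual close to \<open>r\<close>,
  and support still contained in \<open>J\<close>. For two of them, monotonicity of the subdifferentials of the
  norm and of the \<open>\<ell>\<^sub>1\<close>-norm bounds the distance of the unit residuals
  (\<open>certificates_monotone\<close>), and injectivity turns this into a bound on the distance of
  the minimizers (\<open>certificates_lipschitz\<close>). The bound gives uniqueness and the Lipschitz
  property at once.
\<close>

section \<open>The objective and its minimizers\<close>

lemma mem_sr_lasso_sol_iff:
  "x \<in> sr_lasso_sol A (b, lam) \<longleftrightarrow> (\<forall>y. sr_lasso_obj A b lam x \<le> sr_lasso_obj A b lam y)"
  by (simp add: sr_lasso_sol_def is_arg_min_linorder)

lemma norm_le_l1_norm: "norm x \<le> l1_norm x"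
  unfolding l1_norm_def by (rule norm_le_l1_cart)

lemma l1_norm_le_norm: "l1_norm (x :: real ^ 'n) \<le> real CARD('n) * norm x"
proof -
  have "(\<Sum>i\<in>UNIV. \<bar>x $ i\<bar>) \<le> (\<Sum>i\<in>(UNIV :: 'n set). norm x)"
    by (intro sum_mono component_le_norm_cart)
  then show ?thesis by (simp add: l1_norm_def)
qed

lemma l1_norm_triangle_sub: "l1_norm x - l1_norm y \<le> l1_norm (x - y)"
  unfolding l1_norm_def sum_subtractf[symmetric] by (intro sum_mono) auto

lemma continuous_on_l1_norm [continuous_intros]:
  "continuous_on S f \<Longrightarrow> continuous_on S (\<lambda>w. l1_norm (f w))"
  unfolding l1_norm_def by (intro continuous_intros)

lemma continuous_on_matrix_vector_mult [continuous_intros]: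
  fixes A :: "real ^ 'n ^ 'm"
  shows "continuous_on S f \<Longrightarrow> continuous_on S (\<lambda>w. A *v f w)"
  by (rule bounded_linear.continuous_on[OF matrix_vector_mul_bounded_linear])

lemma inner_matrix_vector_mult:
  fixes A :: "real ^ 'n ^ 'm"
  shows "r \<bullet> (A *v x) = (\<Sum>i\<in>UNIV. (column i A \<bullet> r) * x $ i)"
  by (simp add: matrix_mult_sum scalar_mult_eq_scaleR inner_sum_right inner_commute mult.commute)

text \<open>Comparison with \<open>x = 0\<close>: the objective there is \<open>\<parallel>b\<parallel>\<close>.\<close>

lemma sr_lasso_sol_norm_bound:
  assumes "lam > 0" "x \<in> sr_lasso_sol A (b, lam)"
  shows "lam * norm x \<le> norm b"
proof -
  have "lam * norm x \<le> lam * l1_norm x"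
    using assms(1) norm_le_l1_norm[of x] by simp
  also have "\<dots> \<le> sr_lasso_obj A b lam x" by (simp add: sr_lasso_obj_def)
  also have "\<dots> \<le> sr_lasso_obj A b lam 0"
    using assms(2) unfolding mem_sr_lasso_sol_iff by blast
  also have "\<dots> = norm b" by (simp add: sr_lasso_obj_def l1_norm_def)
  finally show ?thesis .
qed

lemma sr_lasso_sol_nonempty:
  assumes "lam > 0"
  shows "sr_lasso_sol A (b, lam) \<noteq> {}"
proof -
  let ?f = "sr_lasso_obj A b lam" and ?K = "cball 0 (norm b / lam)"
  have "continuous_on ?K ?f"
    unfolding sr_lasso_obj_def by (intro continuous_intros)
  moreover have "0 \<in> ?K" using assms by simp
  ultimately obtain x where x: "x \<in> ?K" "\<And>y. y \<in> ?K \<Longrightarrow> ?f x \<le> ?f y"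
    using continuous_attains_inf[OF compact_cball, of 0 "norm b / lam" ?f] by blast
  have "?f x \<le> ?f y" for y
  proof (cases "y \<in> ?K")
    case True then show ?thesis by (rule x(2))
  next
    case False
    have "?f x \<le> ?f 0" using \<open>0 \<in> ?K\<close> by (rule x(2))
    also have "\<dots> = norm b" by (simp add: sr_lasso_obj_def l1_norm_def)
    also have "\<dots> \<le> lam * norm y" using False assms by (simp add: field_simps)
    also have "\<dots> \<le> lam * l1_norm y" using assms norm_le_l1_norm[of y] by simp
    also have "\<dots> \<le> ?f y" by (simp add: sr_lasso_obj_def)
    finally show ?thesis .
  qed
  then show ?thesis using mem_sr_lasso_sol_iff by blast
qed

text \<open>Minimizers for nearby data stay in a fixed ball, and limits of minimizers are minimizers, so
  if there is only one minimizer at \<open>(b, lam)\<close>, the nearby ones must approach it.\<close>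

lemma sr_lasso_sol_upper_semicontinuous:
  fixes A :: "real ^ 'n ^ 'm"
  assumes lam: "lam > 0" and sol: "sr_lasso_sol A (b, lam) = {x}"
    and P: "\<forall>\<^sub>F w in nhds ((b, lam), x). P w"
  shows "\<forall>\<^sub>F q in nhds (b, lam). \<forall>y\<in>sr_lasso_sol A q. P (q, y)"
proof (rule ccontr)
  assume "\<not> ?thesis"
  then have bad: "\<exists>q. dist q (b, lam) < d \<and> (\<exists>y\<in>sr_lasso_sol A q. \<not> P (q, y))" if "d > 0" for d
    using that unfolding eventually_nhds_metric by blast
  have "\<exists>q y. dist q (b, lam) < inverse (real (Suc n)) \<and> y \<in> sr_lasso_sol A q \<and> \<not> P (q, y)"
    for n
    using bad[of "inverse (real (Suc n))"] by (simp only: inverse_positive_iff_positive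
        of_nat_0_less_iff zero_less_Suc) blast
  then obtain q y where q: "\<And>n. dist (q n) (b, lam) < inverse (real (Suc n))"
    and y: "\<And>n. y n \<in> sr_lasso_sol A (q n)" and nP: "\<And>n. \<not> P (q n, y n)"
    by metis
  have q_lim: "q \<longlonglongrightarrow> (b, lam)"
    unfolding tendsto_dist_iff[of q]
    by (rule tendsto_sandwich[OF _ _ tendsto_const LIMSEQ_inverse_real_of_nat])
       (auto simp del: of_nat_Suc intro!: always_eventually less_imp_le[OF q])
  then have b_lim: "(\<lambda>n. fst (q n)) \<longlonglongrightarrow> b" and l_lim: "(\<lambda>n. snd (q n)) \<longlonglongrightarrow> lam"
    using tendsto_fst tendsto_snd by fastforce+
  have "\<forall>\<^sub>F n in sequentially. lam / 2 < snd (q n) \<and> norm (fst (q n)) < norm b + 1"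
    using order_tendstoD(1)[OF l_lim, of "lam / 2"]
      order_tendstoD(2)[OF tendsto_norm[OF b_lim], of "norm b + 1"] lam by (auto elim: eventually_elim2)
  then have "\<forall>\<^sub>F n in sequentially. norm (y n) \<le> (norm b + 1) / (lam / 2)"
  proof (rule eventually_mono)
    fix n assume n: "lam / 2 < snd (q n) \<and> norm (fst (q n)) < norm b + 1"
    have "lam / 2 * norm (y n) \<le> snd (q n) * norm (y n)"
      using n by (intro mult_right_mono) auto
    also have "\<dots> \<le> norm (fst (q n))"
      using n lam y[of n] by (intro sr_lasso_sol_norm_bound) auto
    also have "\<dots> \<le> norm b + 1" using n by simp
    finally show "norm (y n) \<le> (norm b + 1) / (lam / 2)" using lam by (simp add: field_simps)
  qed
  then obtain N where N: "\<And>n. n \<ge> N \<Longrightarrow> norm (y n) \<le> (norm b + 1) / (lam / 2)"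
    unfolding eventually_sequentially by blast
  have "\<forall>n. y (n + N) \<in> cball 0 ((norm b + 1) / (lam / 2))" using N by simp
  then obtain y' s where s: "strict_mono s" and y'_lim: "((\<lambda>n. y (n + N)) \<circ> s) \<longlonglongrightarrow> y'"
    using compact_cball[unfolded compact_def] by metis
  define k where "k n = s n + N" for n
  have k: "strict_mono k" using s by (auto simp: k_def strict_mono_def)
  have yk: "(\<lambda>n. y (k n)) \<longlonglongrightarrow> y'" using y'_lim by (simp add: k_def o_def)
  have qk: "(\<lambda>n. q (k n)) \<longlonglongrightarrow> (b, lam)"
    using LIMSEQ_subseq_LIMSEQ[OF q_lim k] by (simp add: o_def)
  have obj_lim: "(\<lambda>n. sr_lasso_obj A (fst (q (k n))) (snd (q (k n))) (v n))
      \<longlonglongrightarrow> sr_lasso_obj A b lam v'" if "v \<longlonglongrightarrow> v'" for v v'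
  proof -
    have "continuous_on UNIV (\<lambda>w :: ((real^'m) \<times> real) \<times> (real^'n).
            sr_lasso_obj A (fst (fst w)) (snd (fst w)) (snd w))"
      unfolding sr_lasso_obj_def by (intro continuous_intros)
    from continuous_on_tendsto_compose[OF this tendsto_Pair[OF qk that]] show ?thesis by simp
  qed
  have "sr_lasso_obj A b lam y' \<le> sr_lasso_obj A b lam v" for v
  proof (rule LIMSEQ_le[OF obj_lim[OF yk] obj_lim[OF tendsto_const]], intro exI allI impI)
    fix n
    show "sr_lasso_obj A (fst (q (k n))) (snd (q (k n))) (y (k n))
      \<le> sr_lasso_obj A (fst (q (k n))) (snd (q (k n))) v"
      using y[of "k n"] mem_sr_lasso_sol_iff[of _ A "fst (q (k n))" "snd (q (k n))"] by simp
  qed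
  then have "y' = x" using sol mem_sr_lasso_sol_iff by blast
  then have "(\<lambda>n. (q (k n), y (k n))) \<longlonglongrightarrow> ((b, lam), x)"
    using tendsto_Pair[OF qk yk] by simp
  then have "\<forall>\<^sub>F n in sequentially. P (q (k n), y (k n))"
    by (rule eventually_compose_filterlim[OF P])
  then show False using nP by simp
qed

section \<open>Dual certificates\<close>

text \<open>\<open>r\<close> is a subgradient of the norm at the residual \<open>b - A x\<close>, and \<open>A\<^sup>T r\<close> is \<open>lam\<close> times a
  subgradient of the \<open>\<ell>\<^sub>1\<close>-norm at \<open>x\<close>. Writing the first condition without division makes sense
  also for a vanishing residual, which may occur when a certificate is transferred from one
  minimizer to another.\<close>

definition certificate ::
    "real ^ 'n ^ 'm \<Rightarrow> real ^ 'm \<Rightarrow> real \<Rightarrow> real ^ 'n \<Rightarrow> real ^ 'm \<Rightarrow> bool" where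
  "certificate A b lam x r \<longleftrightarrow> norm r = 1 \<and> b - A *v x = norm (b - A *v x) *\<^sub>R r \<and>
     (\<forall>i. \<bar>column i A \<bullet> r\<bar> \<le> lam \<and> (column i A \<bullet> r) * x $ i = lam * \<bar>x $ i\<bar>)"

lemma inner_le_l1_norm:
  assumes "\<forall>i. \<bar>column i A \<bullet> r\<bar> \<le> lam"
  shows "r \<bullet> (A *v x) \<le> lam * l1_norm x"
  unfolding inner_matrix_vector_mult l1_norm_def sum_distrib_left
proof (rule sum_mono)
  fix i
  have "(column i A \<bullet> r) * x $ i \<le> \<bar>column i A \<bullet> r\<bar> * \<bar>x $ i\<bar>"
    by (metis abs_ge_self abs_mult)
  also have "\<dots> \<le> lam * \<bar>x $ i\<bar>" using assms by (intro mult_right_mono) auto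
  finally show "(column i A \<bullet> r) * x $ i \<le> lam * \<bar>x $ i\<bar>" .
qed

lemma certificate_inner_eq:
  assumes "certificate A b lam x r"
  shows "r \<bullet> (A *v x) = lam * l1_norm x"
  using assms unfolding inner_matrix_vector_mult l1_norm_def sum_distrib_left certificate_def
  by simp

text \<open>Weak duality: such \<open>r\<close> are feasible for the dual problem, which maximizes \<open>r \<bullet> b\<close>.\<close>

lemma sr_lasso_obj_ge:
  assumes "norm r = 1" "\<forall>i. \<bar>column i A \<bullet> r\<bar> \<le> lam"
  shows "r \<bullet> b \<le> sr_lasso_obj A b lam x"
proof -
  have "r \<bullet> b = r \<bullet> (b - A *v x) + r \<bullet> (A *v x)" by (simp add: inner_diff_right)
  also have "\<dots> \<le> norm (b - A *v x) + lam * l1_norm x"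
    using norm_cauchy_schwarz[of r "b - A *v x"] inner_le_l1_norm[OF assms(2)] assms(1)
    by (intro add_mono) auto
  finally show ?thesis by (simp add: sr_lasso_obj_def norm_minus_commute)
qed

lemma certificate_obj_eq:
  assumes "certificate A b lam x r"
  shows "sr_lasso_obj A b lam x = r \<bullet> b"
proof -
  have r: "norm r = 1" "b - A *v x = norm (b - A *v x) *\<^sub>R r"
    using assms by (auto simp: certificate_def)
  have "r \<bullet> (b - A *v x) = norm (b - A *v x) * (r \<bullet> r)"
    by (subst r(2)) (rule inner_scaleR_right)
  also have "\<dots> = norm (b - A *v x)" using r(1) by (simp add: dot_square_norm)
  finally show ?thesis using certificate_inner_eq[OF assms]
    by (simp add: sr_lasso_obj_def norm_minus_commute inner_diff_right)
qed

lemma certificate_imp_sol: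
  assumes "certificate A b lam x r"
  shows "x \<in> sr_lasso_sol A (b, lam)"
  unfolding mem_sr_lasso_sol_iff certificate_obj_eq[OF assms]
  using assms by (auto simp: certificate_def intro: sr_lasso_obj_ge)

text \<open>A second minimizer attains the same lower bound, so both estimates behind weak duality must be
  equalities for it, too.\<close>

lemma certificate_transfer:
  assumes cert: "certificate A b lam x r" and y: "y \<in> sr_lasso_sol A (b, lam)"
  shows "certificate A b lam y r"
proof -
  have r: "norm r = 1" and le: "\<forall>i. \<bar>column i A \<bullet> r\<bar> \<le> lam"
    using cert by (auto simp: certificate_def)
  have "sr_lasso_obj A b lam y \<le> r \<bullet> b"
    using y unfolding mem_sr_lasso_sol_iff certificate_obj_eq[OF cert, symmetric] by blast
  then have "norm (b - A *v y) + lam * l1_norm y \<le> r \<bullet> (b - A *v y) + r \<bullet> (A *v y)"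
    by (simp add: sr_lasso_obj_def norm_minus_commute inner_diff_right)
  with norm_cauchy_schwarz[of r "b - A *v y"] inner_le_l1_norm[OF le, of y] r
  have eq1: "r \<bullet> (b - A *v y) = norm r * norm (b - A *v y)"
    and eq2: "r \<bullet> (A *v y) = lam * l1_norm y"
    by auto
  have "b - A *v y = norm (b - A *v y) *\<^sub>R r"
    using eq1 r unfolding norm_cauchy_schwarz_eq by simp
  moreover have "(column i A \<bullet> r) * y $ i = lam * \<bar>y $ i\<bar>" for i
  proof -
    have nonneg: "0 \<le> lam * \<bar>y $ j\<bar> - (column j A \<bullet> r) * y $ j" for j
    proof -
      have "(column j A \<bullet> r) * y $ j \<le> \<bar>column j A \<bullet> r\<bar> * \<bar>y $ j\<bar>"
        by (metis abs_ge_self abs_mult)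
      also have "\<dots> \<le> lam * \<bar>y $ j\<bar>" using le by (intro mult_right_mono) auto
      finally show ?thesis by simp
    qed
    have "(\<Sum>i\<in>UNIV. lam * \<bar>y $ i\<bar> - (column i A \<bullet> r) * y $ i) = 0"
      using eq2 unfolding inner_matrix_vector_mult l1_norm_def sum_distrib_left
      by (simp add: sum_subtractf)
    then have "lam * \<bar>y $ i\<bar> - (column i A \<bullet> r) * y $ i = 0"
      using nonneg by (subst (asm) sum_nonneg_eq_0_iff) auto
    then show ?thesis by simp
  qed
  ultimately show ?thesis using r le by (simp add: certificate_def)
qed

text \<open>Second-order upper bound for the norm, from \<open>sqrt (a\<^sup>2 + s) \<le> a + s / (2 a)\<close>.\<close>

lemma norm_diff_scaleR_le:
  assumes "u \<noteq> 0"
  shows "norm (u - e *\<^sub>R v) \<le> norm u - e * (v \<bullet> (u /\<^sub>R norm u)) + e\<^sup>2 * ((norm v)\<^sup>2 / (2 * norm u))"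
    (is "_ \<le> ?R")
proof -
  have pos: "norm u > 0" using assms by simp
  have "(norm (u - e *\<^sub>R v))\<^sup>2 = (norm u)\<^sup>2 - 2 * e * (v \<bullet> u) + e\<^sup>2 * (norm v)\<^sup>2"
    unfolding power2_norm_eq_inner
    by (simp add: inner_diff_left inner_diff_right inner_commute power2_eq_square algebra_simps)
  moreover have "2 * norm u * ?R = 2 * (norm u)\<^sup>2 - 2 * e * (v \<bullet> u) + e\<^sup>2 * (norm v)\<^sup>2"
    using pos by (simp add: algebra_simps power2_eq_square)
  ultimately have "(norm (u - e *\<^sub>R v))\<^sup>2 + (norm u)\<^sup>2 = 2 * norm u * ?R" by linarith
  moreover have "2 * norm u * norm (u - e *\<^sub>R v) \<le> (norm (u - e *\<^sub>R v))\<^sup>2 + (norm u)\<^sup>2"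
    using sum_squares_bound[of "norm u" "norm (u - e *\<^sub>R v)"] by simp
  ultimately show ?thesis using pos by simp
qed

text \<open>Fermat's rule in each coordinate direction; after dividing by the step length, the quadratic
  term disappears in the limit.\<close>

lemma sol_imp_certificate:
  fixes A :: "real ^ 'n ^ 'm"
  assumes lam: "lam > 0" and sol: "x \<in> sr_lasso_sol A (b, lam)" and ne: "A *v x \<noteq> b"
  shows "certificate A b lam x ((b - A *v x) /\<^sub>R norm (b - A *v x))"
proof -
  define u where "u = b - A *v x"
  define r where "r = u /\<^sub>R norm u"
  have u: "u \<noteq> 0" using ne by (simp add: u_def)
  have "\<bar>column i A \<bullet> r\<bar> \<le> lam \<and> (column i A \<bullet> r) * x $ i = lam * \<bar>x $ i\<bar>" for i
  proof -
    define g where "g = column i A \<bullet> r"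
    define C where "C = (norm (column i A))\<^sup>2 / (2 * norm u)"
    have step: "e * g \<le> lam * (\<bar>x $ i + e\<bar> - \<bar>x $ i\<bar>) + e\<^sup>2 * C" for e
    proof -
      let ?y = "x + e *\<^sub>R axis i 1"
      have Ay: "A *v ?y = A *v x + e *\<^sub>R column i A"
        by (simp add: matrix_vector_right_distrib matrix_vector_mult_scaleR matrix_vector_mult_basis)
      have "norm (A *v ?y - b) = norm (u - e *\<^sub>R column i A)"
        unfolding Ay u_def by (subst norm_minus_commute) (simp add: algebra_simps)
      also have "\<dots> \<le> norm u - e * g + e\<^sup>2 * C"
        using norm_diff_scaleR_le[OF u, of e "column i A"] by (simp add: g_def C_def r_def)
      finally have 1: "norm (A *v ?y - b) \<le> norm u - e * g + e\<^sup>2 * C" .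
      have "l1_norm ?y = (\<Sum>j\<in>UNIV. \<bar>x $ j\<bar> + (if j = i then \<bar>x $ i + e\<bar> - \<bar>x $ i\<bar> else 0))"
        unfolding l1_norm_def by (rule sum.cong) (auto simp: axis_def)
      then have 2: "l1_norm ?y = l1_norm x + (\<bar>x $ i + e\<bar> - \<bar>x $ i\<bar>)"
        by (simp add: sum.distrib l1_norm_def)
      have "norm u + lam * l1_norm x \<le> norm (A *v ?y - b) + lam * l1_norm ?y"
        using sol unfolding mem_sr_lasso_sol_iff sr_lasso_obj_def
        by (simp add: u_def norm_minus_commute)
      with 1 show ?thesis unfolding 2 distrib_left by linarith
    qed
    have lim: "a \<le> c" if le: "\<And>e. 0 < e \<Longrightarrow> e < 1 \<Longrightarrow> e * a \<le> e * c + e\<^sup>2 * D" for a c D :: real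
    proof (rule tendsto_le[OF trivial_limit_at_right_real])
      show "((\<lambda>e. c + e * D) \<longlongrightarrow> c) (at_right 0)" by (auto intro!: tendsto_eq_intros)
      show "((\<lambda>e. a) \<longlongrightarrow> a) (at_right (0::real))" by simp
      have "a \<le> c + e * D" if "0 < e" "e < 1" for e
      proof -
        have "e * a \<le> e * (c + e * D)"
          using le[OF that] by (simp add: algebra_simps power2_eq_square)
        then show ?thesis using that by simp
      qed
      then show "\<forall>\<^sub>F e in at_right 0. a \<le> c + e * D"
        by (auto simp: eventually_at_right_field intro!: exI[of _ 1])
    qed
    have abs_step: "e * g \<le> \<bar>e\<bar> * lam + e\<^sup>2 * C" for e
    proof -
      have "lam * (\<bar>x $ i + e\<bar> - \<bar>x $ i\<bar>) \<le> lam * \<bar>e\<bar>"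
        using lam by (intro mult_left_mono) auto
      with step[of e] show ?thesis by (simp add: mult.commute)
    qed
    have "g \<le> lam"
    proof (rule lim)
      fix e :: real assume "0 < e"
      then show "e * g \<le> e * lam + e\<^sup>2 * C" using abs_step[of e] by simp
    qed
    moreover have "- g \<le> lam"
    proof (rule lim)
      fix e :: real assume "0 < e"
      then show "e * (- g) \<le> e * lam + e\<^sup>2 * C" using abs_step[of "- e"] by simp
    qed
    ultimately have g: "\<bar>g\<bar> \<le> lam" by simp
    have "lam * \<bar>x $ i\<bar> \<le> g * x $ i"
    proof (rule lim)
      \<comment> \<open>Shrinking the coordinate decreases its modulus at full rate.\<close>
      fix e :: real assume e: "0 < e" "e < 1"
      have "\<bar>x $ i + - (e * x $ i)\<bar> = \<bar>(1 - e) * x $ i\<bar>" by (simp add: algebra_simps)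
      also have "\<dots> = (1 - e) * \<bar>x $ i\<bar>" using e by (simp add: abs_mult)
      finally have shrink: "\<bar>x $ i + - (e * x $ i)\<bar> = (1 - e) * \<bar>x $ i\<bar>" .
      show "e * (lam * \<bar>x $ i\<bar>) \<le> e * (g * x $ i) + e\<^sup>2 * ((x $ i)\<^sup>2 * C)"
        using step[of "- (e * x $ i)"] unfolding shrink
        by (simp add: algebra_simps power_mult_distrib)
    qed
    moreover have "g * x $ i \<le> \<bar>g\<bar> * \<bar>x $ i\<bar>" by (metis abs_ge_self abs_mult)
    moreover have "\<bar>g\<bar> * \<bar>x $ i\<bar> \<le> lam * \<bar>x $ i\<bar>" using g by (intro mult_right_mono) auto
    ultimately show ?thesis using g by (simp add: g_def)
  qed
  then show ?thesis using u
    by (simp add: certificate_def u_def[symmetric] r_def[symmetric]) (simp add: r_def)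
qed

section \<open>The conditions on the equicorrelation set\<close>

lemma subspace_coeff_space: "subspace (coeff_space J)"
  by (simp add: subspace_def coeff_space_def)

lemma submatrix_mult_eq:
  assumes "z \<in> coeff_space J"
  shows "submatrix_mult A J z = A *v z"
proof -
  have "A *v z = (\<Sum>i\<in>UNIV. z $ i *\<^sub>R column i A)"
    by (simp add: matrix_mult_sum scalar_mult_eq_scaleR)
  also have "\<dots> = (\<Sum>i\<in>J. z $ i *\<^sub>R column i A)"
    using assms by (intro sum.mono_neutral_right) (auto simp: coeff_space_def)
  finally show ?thesis by (simp add: submatrix_mult_def)
qed

lemma J_SR_eq:
  "J_SR A b lam x = {i. \<bar>column i A \<bullet> ((b - A *v x) /\<^sub>R norm (b - A *v x))\<bar> = lam}"
  by (simp add: J_SR_def norm_minus_commute)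

lemma certificate_support:
  assumes "certificate A b lam x r" "x $ i \<noteq> 0"
  shows "\<bar>column i A \<bullet> r\<bar> = lam"
proof -
  have le: "\<bar>column i A \<bullet> r\<bar> \<le> lam" and eq: "(column i A \<bullet> r) * x $ i = lam * \<bar>x $ i\<bar>"
    using assms(1) by (auto simp: certificate_def)
  have "lam * \<bar>x $ i\<bar> \<le> \<bar>column i A \<bullet> r\<bar> * \<bar>x $ i\<bar>" by (metis eq abs_ge_self abs_mult)
  then show ?thesis using le assms(2) by simp
qed

text \<open>Since \<open>x\<close> is supported in \<open>J\<close>, the vectors \<open>b\<close> and \<open>b - A x\<close>, the latter a multiple of \<open>r\<close>, agree modulo
  the range of \<open>A\<^sub>J\<close>; hence \<open>b\<close> may be replaced by \<open>r\<close> in the range condition.\<close>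

lemma submatrix_conditions_iff:
  fixes A :: "real ^ 'n ^ 'm"
  assumes cert: "certificate A b lam x r" and ne: "A *v x \<noteq> b"
    and J: "J = {i. \<bar>column i A \<bullet> r\<bar> = lam}"
  shows "submatrix_ker A J = {0} \<and> b \<notin> submatrix_rge A J \<longleftrightarrow>
    (\<forall>z\<in>coeff_space J. \<forall>\<tau>. A *v z + \<tau> *\<^sub>R r = 0 \<longrightarrow> z = 0 \<and> \<tau> = 0)"
    (is "?L \<longleftrightarrow> ?R")
proof -
  have x: "x \<in> coeff_space J"
    using certificate_support[OF cert] by (auto simp: coeff_space_def J)
  define t where "t = norm (b - A *v x)"
  have t: "t \<noteq> 0" using ne by (simp add: t_def)
  have b: "b = A *v x + t *\<^sub>R r"
    using cert unfolding t_def certificate_def by (metis add.commute diff_add_cancel)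
  have ker: "submatrix_ker A J = {0} \<longleftrightarrow> (\<forall>z\<in>coeff_space J. A *v z = 0 \<longrightarrow> z = 0)"
  proof -
    have "submatrix_ker A J = {z \<in> coeff_space J. A *v z = 0}"
      unfolding submatrix_ker_def by (rule Collect_cong) (metis submatrix_mult_eq)
    moreover have "0 \<in> coeff_space J" by (rule subspace_0[OF subspace_coeff_space])
    ultimately show ?thesis by (simp only: set_eq_iff mem_Collect_eq singleton_iff)
        (metis matrix_vector_mult_0_right)
  qed
  have rge: "b \<in> submatrix_rge A J \<longleftrightarrow> (\<exists>z\<in>coeff_space J. b = A *v z)"
    unfolding submatrix_rge_def image_iff by (metis submatrix_mult_eq)
  show ?thesis
  proof
    assume L: ?L
    show ?R
    proof (intro ballI allI impI)
      fix z \<tau> assume z: "z \<in> coeff_space J" and eq: "A *v z + \<tau> *\<^sub>R r = 0"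
      have "\<tau> = 0"
      proof (rule ccontr)
        assume "\<tau> \<noteq> 0"
        have "A *v z = - (\<tau> *\<^sub>R r)" using eq by (simp add: eq_neg_iff_add_eq_0)
        then have "b = A *v (x - (t / \<tau>) *\<^sub>R z)"
          using \<open>\<tau> \<noteq> 0\<close> by (subst b) (simp add: matrix_vector_mult_diff_distrib matrix_vector_mult_scaleR)
        moreover have "x - (t / \<tau>) *\<^sub>R z \<in> coeff_space J"
          using x z by (intro subspace_diff subspace_scale subspace_coeff_space)
        ultimately show False using L rge by blast
      qed
      with eq z L ker show "z = 0 \<and> \<tau> = 0" by simp
    qed
  next
    assume R: ?R
    have "b \<noteq> A *v z" if z: "z \<in> coeff_space J" for z
    proof
      assume "b = A *v z"
      moreover have "A *v (x - z) + t *\<^sub>R r = b - A *v z"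
        by (subst b) (simp add: matrix_vector_mult_diff_distrib)
      ultimately have "A *v (x - z) + t *\<^sub>R r = 0" by simp
      moreover have "x - z \<in> coeff_space J" by (intro subspace_diff subspace_coeff_space x z)
      ultimately show False using R t by blast
    qed
    moreover have "z = 0" if "z \<in> coeff_space J" "A *v z = 0" for z
      using R that by (metis add.right_neutral scaleR_zero_left)
    ultimately show ?L using ker rge by blast
  qed
qed

section \<open>Necessity\<close>

text \<open>If \<open>x\<close> is supported on all of \<open>J\<close>, then for a nontrivial solution of \<open>A z + \<tau> r = 0\<close> a short
  move of \<open>x\<close> along \<open>z\<close> preserves the certificate, since signs and the sign of the residual length are
  stable under small changes.\<close>

lemma second_minimizer:
  fixes A :: "real ^ 'n ^ 'm"
  assumes cert: "certificate A b lam x r" and ne: "A *v x \<noteq> b"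
    and full: "\<And>i. x $ i = 0 \<Longrightarrow> z $ i = 0"
    and eq: "A *v z + \<tau> *\<^sub>R r = 0" and z: "z \<noteq> 0"
  shows "\<not> is_singleton (sr_lasso_sol A (b, lam))"
proof -
  define t where "t = norm (b - A *v x)"
  have t: "t > 0" using ne by (simp add: t_def)
  have res: "b - A *v x = t *\<^sub>R r" and r: "norm r = 1"
    using cert unfolding t_def certificate_def by blast+
  have "\<forall>\<^sub>F e in at_right 0. t + e * \<tau> > 0"
    by (rule order_tendstoD(1)[OF _ t]) (auto intro!: tendsto_eq_intros)
  moreover have "\<forall>\<^sub>F e in at_right 0. \<forall>i. x $ i \<noteq> 0 \<longrightarrow> (x $ i + e * z $ i) * x $ i > 0"
  proof (rule eventually_all_finite)
    fix i
    show "\<forall>\<^sub>F e in at_right 0. x $ i \<noteq> 0 \<longrightarrow> (x $ i + e * z $ i) * x $ i > 0"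
    proof (cases "x $ i = 0")
      case False
      have "((\<lambda>e. (x $ i + e * z $ i) * x $ i) \<longlongrightarrow> (x $ i)\<^sup>2) (at_right 0)"
        by (auto intro!: tendsto_eq_intros simp: power2_eq_square)
      from order_tendstoD(1)[OF this] False show ?thesis by simp
    qed simp
  qed
  ultimately have "\<forall>\<^sub>F e in at_right 0. e > 0 \<and> t + e * \<tau> > 0 \<and>
      (\<forall>i. x $ i \<noteq> 0 \<longrightarrow> (x $ i + e * z $ i) * x $ i > 0)"
    using eventually_at_right_less[of "0::real"] by eventually_elim auto
  then obtain e where e: "e > 0" "t + e * \<tau> > 0"
    and sgn: "\<And>i. x $ i \<noteq> 0 \<Longrightarrow> (x $ i + e * z $ i) * x $ i > 0"
    using eventually_happens'[OF trivial_limit_at_right_real] by blast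
  let ?y = "x + e *\<^sub>R z"
  have "certificate A b lam ?y r"
    unfolding certificate_def
  proof (intro conjI allI)
    have "A *v z = - (\<tau> *\<^sub>R r)" using eq by (simp add: eq_neg_iff_add_eq_0)
    then have "b - A *v ?y = (t + e * \<tau>) *\<^sub>R r"
      using res by (simp add: matrix_vector_right_distrib matrix_vector_mult_scaleR algebra_simps)
    then show "b - A *v ?y = norm (b - A *v ?y) *\<^sub>R r" using e(2) r by simp
    fix i
    show "\<bar>column i A \<bullet> r\<bar> \<le> lam" using cert by (simp add: certificate_def)
    have eqi: "(column i A \<bullet> r) * x $ i = lam * \<bar>x $ i\<bar>" using cert by (simp add: certificate_def)
    show "(column i A \<bullet> r) * ?y $ i = lam * \<bar>?y $ i\<bar>"
    proof (cases "x $ i" "0 :: real" rule: linorder_cases)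
      case equal then show ?thesis using full by simp
    next
      case less
      then have "?y $ i < 0" using sgn[of i] by (simp add: zero_less_mult_iff)
      moreover have "column i A \<bullet> r = - lam"
        using eqi less mult_right_cancel[of "x $ i" "column i A \<bullet> r" "- lam"] by simp
      ultimately show ?thesis by (simp add: algebra_simps)
    next
      case greater
      then have "?y $ i > 0" using sgn[of i] by (simp add: zero_less_mult_iff)
      then show ?thesis using eqi greater by simp
    qed
  qed (rule r)
  then have "?y \<in> sr_lasso_sol A (b, lam)" by (rule certificate_imp_sol)
  moreover have "x \<in> sr_lasso_sol A (b, lam)" using cert by (rule certificate_imp_sol)
  moreover have "?y \<noteq> x" using e(1) z by simp
  ultimately show ?thesis by (metis is_singletonE singletonD)
qed

text \<open>The support of \<open>x\<close> may be smaller than \<open>J\<close>, in which case a move along \<open>z\<close> may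
  give a vanishing coordinate of \<open>x\<close> the wrong sign. Moving \<open>b\<close> by \<open>e A w\<close> compensates for moving \<open>x\<close> by \<open>e w\<close>, so the vector
  of signs \<open>w\<close> can be used to fill up the support at the price of an arbitrarily small change of \<open>b\<close>.\<close>

lemma single_valued_imp_injective:
  fixes A :: "real ^ 'n ^ 'm"
  assumes lam: "lam > 0" and cert: "certificate A b lam x r" and ne: "A *v x \<noteq> b"
    and single: "\<forall>\<^sub>F b' in nhds b. is_singleton (sr_lasso_sol A (b', lam))"
    and z: "z \<in> coeff_space {i. \<bar>column i A \<bullet> r\<bar> = lam}" and eq: "A *v z + \<tau> *\<^sub>R r = 0"
  shows "z = 0 \<and> \<tau> = 0"
proof (rule ccontr)
  assume nontrivial: "\<not> ?thesis"
  have "norm r = 1" using cert by (simp add: certificate_def)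
  then have z0: "z \<noteq> 0" using eq nontrivial by auto
  define w :: "real ^ 'n"
    where "w = (\<chi> i. if \<bar>column i A \<bullet> r\<bar> = lam then sgn (column i A \<bullet> r) else 0)"
  have "((\<lambda>e. b + e *\<^sub>R (A *v w)) \<longlongrightarrow> b) (at_right 0)"
    by (auto intro!: tendsto_eq_intros)
  then have "\<forall>\<^sub>F e in at_right 0. is_singleton (sr_lasso_sol A (b + e *\<^sub>R (A *v w), lam))"
    by (rule eventually_compose_filterlim[OF single])
  then have "\<forall>\<^sub>F e in at_right 0. e > 0 \<and> is_singleton (sr_lasso_sol A (b + e *\<^sub>R (A *v w), lam))"
    using eventually_at_right_less[of "0::real"] by eventually_elim auto
  then obtain e where e: "e > 0" "is_singleton (sr_lasso_sol A (b + e *\<^sub>R (A *v w), lam))"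
    using eventually_happens'[OF trivial_limit_at_right_real] by blast
  let ?y = "x + e *\<^sub>R w" and ?b = "b + e *\<^sub>R (A *v w)"
  have res: "?b - A *v ?y = b - A *v x"
    by (simp add: matrix_vector_right_distrib matrix_vector_mult_scaleR)
  have sgn_y: "?y $ i \<noteq> 0 \<and> (column i A \<bullet> r) * ?y $ i = lam * \<bar>?y $ i\<bar>"
    if J: "\<bar>column i A \<bullet> r\<bar> = lam" for i
  proof -
    have eqi: "(column i A \<bullet> r) * x $ i = lam * \<bar>x $ i\<bar>" using cert by (simp add: certificate_def)
    consider "column i A \<bullet> r = lam" | "column i A \<bullet> r = - lam" using J by linarith
    then show ?thesis
    proof cases
      case 1
      then have "x $ i \<ge> 0" using eqi lam by simp
      then show ?thesis using 1 e(1) lam by (simp add: w_def)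
    next
      case 2
      have "lam * (x $ i + \<bar>x $ i\<bar>) = 0" using eqi unfolding 2 by (simp add: distrib_left)
      then have "x $ i \<le> 0" using lam by auto
      then show ?thesis using 2 e(1) lam by (simp add: w_def algebra_simps)
    qed
  qed
  have "certificate A ?b lam ?y r"
    unfolding certificate_def res
  proof (intro conjI allI)
    fix i
    show "(column i A \<bullet> r) * ?y $ i = lam * \<bar>?y $ i\<bar>"
    proof (cases "\<bar>column i A \<bullet> r\<bar> = lam")
      case False
      then have "?y $ i = 0" using certificate_support[OF cert, of i] by (auto simp: w_def)
      then show ?thesis by simp
    qed (use sgn_y in blast)
  qed (use cert in \<open>auto simp: certificate_def\<close>)
  moreover have "A *v ?y \<noteq> ?b" using res ne by (metis right_minus_eq)
  moreover have "z $ i = 0" if "?y $ i = 0" for i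
    using z sgn_y[of i] that by (auto simp: coeff_space_def)
  ultimately have "\<not> is_singleton (sr_lasso_sol A (?b, lam))"
    using eq z0 by (rule second_minimizer)
  then show False using e(2) by contradiction
qed

section \<open>Sufficiency\<close>

text \<open>Two minimizers share \<open>r\<close>, so their residuals differ by a multiple of \<open>r\<close>. Hence their difference,
  paired with that of the residual lengths, lies in the kernel of the injective map.\<close>

lemma injective_imp_unique:
  fixes A :: "real ^ 'n ^ 'm"
  assumes cert: "certificate A b lam x r" and J: "J = {i. \<bar>column i A \<bullet> r\<bar> = lam}"
    and inj: "\<forall>z\<in>coeff_space J. \<forall>\<tau>. A *v z + \<tau> *\<^sub>R r = 0 \<longrightarrow> z = 0 \<and> \<tau> = 0"
  shows "sr_lasso_sol A (b, lam) = {x}"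
proof -
  have "y = x" if y: "y \<in> sr_lasso_sol A (b, lam)" for y
  proof -
    have cert': "certificate A b lam y r" using cert y by (rule certificate_transfer)
    have "y - x \<in> coeff_space J"
      using certificate_support[OF cert] certificate_support[OF cert']
      by (intro subspace_diff subspace_coeff_space) (auto simp: coeff_space_def J)
    moreover have "A *v (y - x) + (norm (b - A *v y) - norm (b - A *v x)) *\<^sub>R r = 0"
      using cert cert' unfolding certificate_def
      by (simp add: matrix_vector_mult_diff_distrib scaleR_diff_left)
    ultimately show ?thesis using inj by (metis right_minus_eq)
  qed
  then show ?thesis using certificate_imp_sol[OF cert] by blast
qed

text \<open>The inequality comes from comparing two evaluations of \<open>(r\<^sub>1 - r\<^sub>2) \<bullet> (A x\<^sub>1 - A x\<^sub>2)\<close>. Up to the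
  perturbation of the weights it is nonnegative, because \<open>A\<^sup>T r\<^sub>k\<close> are weighted \<open>\<ell>\<^sub>1\<close>-subgradients.
  On the other hand \<open>A x\<^sub>k = b\<^sub>k - t\<^sub>k r\<^sub>k\<close>, and for residuals \<open>t\<^sub>k r\<^sub>k\<close>
  with unit vectors \<open>r\<^sub>k\<close> one has \<open>(r\<^sub>1 - r\<^sub>2) \<bullet> (t\<^sub>1 r\<^sub>1 - t\<^sub>2 r\<^sub>2) = (t\<^sub>1 + t\<^sub>2) / 2 \<cdot> \<parallel>r\<^sub>1 - r\<^sub>2\<parallel>\<^sup>2\<close>. This identity
  plays the role of strong convexity of the norm in directions transversal to the residual.\<close>

lemma certificates_monotone:
  fixes A :: "real ^ 'n ^ 'm"
  assumes c1: "certificate A b1 l1 x1 r1" and c2: "certificate A b2 l2 x2 r2"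
  shows "(norm (b1 - A *v x1) + norm (b2 - A *v x2)) / 2 * (norm (r1 - r2))\<^sup>2
    \<le> norm (r1 - r2) * norm (b1 - b2) + \<bar>l1 - l2\<bar> * l1_norm (x1 - x2)"
proof -
  define t1 t2 where "t1 = norm (b1 - A *v x1)" and "t2 = norm (b2 - A *v x2)"
  have r: "r1 \<bullet> r1 = 1" "r2 \<bullet> r2 = 1"
    using c1 c2 by (auto simp: certificate_def dot_square_norm)
  have A: "A *v x1 = b1 - t1 *\<^sub>R r1" "A *v x2 = b2 - t2 *\<^sub>R r2"
    using c1 c2 unfolding certificate_def t1_def t2_def by (metis add_diff_cancel_left' diff_add_cancel)+
  have "r1 \<bullet> (A *v x2) \<le> l1 * l1_norm x2" "r2 \<bullet> (A *v x1) \<le> l2 * l1_norm x1"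
    using c1 c2 by (auto simp: certificate_def intro: inner_le_l1_norm)
  then have "(l1 - l2) * (l1_norm x1 - l1_norm x2) \<le> (r1 - r2) \<bullet> (A *v x1 - A *v x2)"
    using certificate_inner_eq[OF c1] certificate_inner_eq[OF c2]
    by (simp add: inner_diff_left inner_diff_right algebra_simps)
  moreover have "(r1 - r2) \<bullet> (A *v x1 - A *v x2)
      = (r1 - r2) \<bullet> (b1 - b2) - (t1 + t2) / 2 * (norm (r1 - r2))\<^sup>2"
  proof -
    have "(r1 - r2) \<bullet> (t1 *\<^sub>R r1 - t2 *\<^sub>R r2) = (t1 + t2) / 2 * ((r1 - r2) \<bullet> (r1 - r2))"
      using r by (simp add: inner_diff_left inner_diff_right inner_commute[of r2 r1] field_simps)
    moreover have "A *v x1 - A *v x2 = (b1 - b2) - (t1 *\<^sub>R r1 - t2 *\<^sub>R r2)"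
      unfolding A by simp
    ultimately show ?thesis by (simp add: inner_diff_right power2_norm_eq_inner)
  qed
  moreover have "(r1 - r2) \<bullet> (b1 - b2) \<le> norm (r1 - r2) * norm (b1 - b2)"
    by (rule norm_cauchy_schwarz)
  moreover have "- (\<bar>l1 - l2\<bar> * l1_norm (x1 - x2)) \<le> (l1 - l2) * (l1_norm x1 - l1_norm x2)"
  proof -
    have "\<bar>l1_norm x1 - l1_norm x2\<bar> \<le> l1_norm (x1 - x2)"
      using l1_norm_triangle_sub[of x1 x2] l1_norm_triangle_sub[of x2 x1]
      by (simp add: l1_norm_def abs_minus_commute)
    then have "\<bar>(l1 - l2) * (l1_norm x1 - l1_norm x2)\<bar> \<le> \<bar>l1 - l2\<bar> * l1_norm (x1 - x2)"
      unfolding abs_mult by (intro mult_left_mono) auto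
    then show ?thesis by linarith
  qed
  ultimately show ?thesis unfolding t1_def t2_def by linarith
qed

text \<open>Here \<open>k\<close> is the lower bound of \<open>(z, \<tau>) \<mapsto> A z + \<tau> r\<close> on \<open>\<real>\<^sup>J \<times> \<real>\<close>, at the unit residual \<open>r\<close> of the
  reference point; half of it survives at \<open>r1\<close>. Applied to the difference of the
  minimizers and of the residual lengths, this controls \<open>\<parallel>x1 - x2\<parallel>\<close> by \<open>\<parallel>r1 - r2\<parallel>\<close> and the data; the
  monotonicity estimate, which is quadratic on the left and linear on the right, then
  controls \<open>\<parallel>r1 - r2\<parallel>\<close> by \<open>M t k\<close> times the distance of the data. The first summand of \<open>M\<close> covers
  the case that \<open>\<parallel>r1 - r2\<parallel>\<close> is at most that distance; otherwise one factor \<open>\<parallel>r1 - r2\<parallel>\<close> cancels.\<close>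

lemma certificates_lipschitz:
  fixes A :: "real ^ 'n ^ 'm"
  defines "M \<equiv> \<lambda>t k. 1 + (2 / t) * (1 + real CARD('n) * (2 / k) * (1 + 2 * t))"
  assumes k: "k > 0" and t: "t > 0"
    and bound: "\<And>z \<tau>. z \<in> coeff_space J \<Longrightarrow> k * norm (z, \<tau>) \<le> norm (A *v z + \<tau> *\<^sub>R r)"
    and c1: "certificate A b1 l1 x1 r1" and c2: "certificate A b2 l2 x2 r2"
    and J: "x1 \<in> coeff_space J" "x2 \<in> coeff_space J"
    and near: "norm (r1 - r) \<le> k / 2"
    and t1: "t / 2 \<le> norm (b1 - A *v x1)"
    and t2: "t / 2 \<le> norm (b2 - A *v x2)" "norm (b2 - A *v x2) \<le> 2 * t"
  shows "norm (x1 - x2) \<le> 2 / k * (1 + 2 * t * M t k) * dist (b1, l1) (b2, l2)"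
proof -
  define s1 s2 where "s1 = norm (b1 - A *v x1)" and "s2 = norm (b2 - A *v x2)"
  define \<rho> where "\<rho> = norm (r1 - r2)"
  define d where "d = dist (b1, l1) (b2, l2)"
  define N where "N = real CARD('n)"
  have d: "norm (b1 - b2) \<le> d" "\<bar>l1 - l2\<bar> \<le> d" "d \<ge> 0"
    using dist_fst_le[of "(b1, l1)" "(b2, l2)"] dist_snd_le[of "(b1, l1)" "(b2, l2)"]
    by (auto simp: d_def dist_norm)
  have \<rho>0: "\<rho> \<ge> 0" by (simp add: \<rho>_def)
  have x: "norm (x1 - x2) \<le> 2 / k * (d + 2 * t * \<rho>)"
  proof -
    let ?z = "x1 - x2" and ?\<tau> = "s1 - s2"
    have A: "A *v x1 = b1 - s1 *\<^sub>R r1" "A *v x2 = b2 - s2 *\<^sub>R r2"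
      using c1 c2 unfolding certificate_def s1_def s2_def
      by (metis add_diff_cancel_left' diff_add_cancel)+
    have "A *v ?z + ?\<tau> *\<^sub>R r = (b1 - b2) - s2 *\<^sub>R (r1 - r2) - ?\<tau> *\<^sub>R (r1 - r)"
      unfolding matrix_vector_mult_diff_distrib A by (simp add: algebra_simps)
    then have "norm (A *v ?z + ?\<tau> *\<^sub>R r) \<le> norm (b1 - b2) + s2 * \<rho> + \<bar>?\<tau>\<bar> * norm (r1 - r)"
      using norm_triangle_ineq4[of "(b1 - b2) - s2 *\<^sub>R (r1 - r2)" "?\<tau> *\<^sub>R (r1 - r)"]
        norm_triangle_ineq4[of "b1 - b2" "s2 *\<^sub>R (r1 - r2)"] by (simp add: \<rho>_def s2_def)
    also have "\<dots> \<le> d + 2 * t * \<rho> + norm (?z, ?\<tau>) * (k / 2)"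
      using d(1) near t2(2) \<rho>0 t norm_snd_le[of ?\<tau> ?z]
      by (intro add_mono mult_mono) (auto simp: s2_def)
    finally have "k / 2 * norm (?z, ?\<tau>) \<le> d + 2 * t * \<rho>"
      using bound[of ?z ?\<tau>] subspace_diff[OF subspace_coeff_space J]
      by (simp add: mult.commute)
    moreover have "k / 2 * norm ?z \<le> k / 2 * norm (?z, ?\<tau>)"
      using k norm_fst_le[of ?z ?\<tau>] by simp
    ultimately have "k / 2 * norm ?z \<le> d + 2 * t * \<rho>" by linarith
    then show ?thesis using k by (simp add: field_simps)
  qed
  have "\<rho> \<le> M t k * d"
  proof (cases "\<rho> \<le> d")
    case True
    have "1 \<le> M t k" using k t by (simp add: M_def)
    then have "1 * d \<le> M t k * d" using d(3) by (rule mult_right_mono)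
    with True show ?thesis by simp
  next
    case False
    then have \<rho>: "\<rho> > 0" "d \<le> \<rho>" using d(3) by auto
    have "t / 2 * \<rho>\<^sup>2 \<le> (s1 + s2) / 2 * \<rho>\<^sup>2"
      using t1 t2(1) by (intro mult_right_mono) (auto simp: s1_def s2_def)
    also have "\<dots> \<le> \<rho> * norm (b1 - b2) + \<bar>l1 - l2\<bar> * l1_norm (x1 - x2)"
      unfolding s1_def s2_def \<rho>_def by (rule certificates_monotone[OF c1 c2])
    also have "\<dots> \<le> \<rho> * d + d * (N * (2 / k * (\<rho> + 2 * t * \<rho>)))"
    proof -
      have "l1_norm (x1 - x2) \<le> N * norm (x1 - x2)" unfolding N_def by (rule l1_norm_le_norm)
      also have "\<dots> \<le> N * (2 / k * (d + 2 * t * \<rho>))"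
        using x by (intro mult_left_mono) (auto simp: N_def)
      also have "\<dots> \<le> N * (2 / k * (\<rho> + 2 * t * \<rho>))"
        using \<rho> k by (intro mult_left_mono) (auto simp: N_def)
      finally show ?thesis
        using d \<rho> by (intro add_mono mult_mono) (auto simp: l1_norm_def sum_nonneg)
    qed
    also have "\<dots> = \<rho> * ((1 + N * (2 / k) * (1 + 2 * t)) * d)"
      by (simp add: algebra_simps add_divide_distrib)
    finally have "\<rho> * (t / 2 * \<rho>) \<le> \<rho> * ((1 + N * (2 / k) * (1 + 2 * t)) * d)"
      by (simp add: power2_eq_square algebra_simps)
    then have "t / 2 * \<rho> \<le> (1 + N * (2 / k) * (1 + 2 * t)) * d" using \<rho>(1) by simp
    then have "\<rho> \<le> (2 / t) * ((1 + N * (2 / k) * (1 + 2 * t)) * d)" using t by (simp add: field_simps)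
    also have "\<dots> \<le> M t k * d" using d(3) by (simp add: M_def N_def distrib_right mult.assoc)
    finally show ?thesis .
  qed
  then have "2 / k * (d + 2 * t * \<rho>) \<le> 2 / k * (d + 2 * t * (M t k * d))"
    using k t by (intro mult_left_mono add_left_mono) auto
  also have "\<dots> = 2 / k * (1 + 2 * t * M t k) * d" by (simp add: algebra_simps)
  finally show ?thesis using x unfolding d_def by linarith
qed

lemma injective_imp_bounded_below:
  fixes A :: "real ^ 'n ^ 'm"
  assumes "\<forall>z\<in>coeff_space J. \<forall>\<tau>. A *v z + \<tau> *\<^sub>R r = 0 \<longrightarrow> z = 0 \<and> \<tau> = 0"
  obtains k where "k > 0"
    "\<And>z \<tau>. z \<in> coeff_space J \<Longrightarrow> k * norm (z, \<tau>) \<le> norm (A *v z + \<tau> *\<^sub>R r)"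
proof -
  let ?f = "\<lambda>p :: (real ^ 'n) \<times> real. A *v fst p + snd p *\<^sub>R r" and ?S = "coeff_space J \<times> UNIV"
  have sub: "subspace ?S" by (intro subspace_Times subspace_coeff_space subspace_UNIV)
  have lin: "bounded_linear ?f"
    by (intro bounded_linear_add bounded_linear_compose[OF matrix_vector_mul_bounded_linear bounded_linear_fst]
        bounded_linear_compose[OF bounded_linear_scaleR_left bounded_linear_snd])
  have "\<forall>p\<in>?S. ?f p = 0 \<longrightarrow> p = 0" using assms by (auto simp: zero_prod_def)
  from injective_imp_isometric[OF closed_subspace[OF sub] sub lin this]
  obtain k where "k > 0" "\<forall>p\<in>?S. k * norm p \<le> norm (?f p)" by auto
  then show ?thesis by (intro that[of k]) auto
qed

text \<open>All requirements of the Lipschitz estimate are open conditions at the reference point. In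
  particular, the strict inequalities \<open>\<bar>A\<^sub>i \<bullet> r\<bar> < lam\<close> off \<open>J\<close> persist, which keeps the supports inside \<open>J\<close>.\<close>

lemma injective_imp_locally_lipschitz:
  fixes A :: "real ^ 'n ^ 'm"
  assumes lam: "lam > 0" and cert: "certificate A b lam x r" and ne: "A *v x \<noteq> b"
    and J: "J = {i. \<bar>column i A \<bullet> r\<bar> = lam}"
    and inj: "\<forall>z\<in>coeff_space J. \<forall>\<tau>. A *v z + \<tau> *\<^sub>R r = 0 \<longrightarrow> z = 0 \<and> \<tau> = 0"
  shows "locally_single_valued_lipschitz (UNIV \<times> {0<..}) (sr_lasso_sol A) (b, lam)"
proof -
  obtain k where k: "k > 0"
    and bound: "\<And>z \<tau>. z \<in> coeff_space J \<Longrightarrow> k * norm (z, \<tau>) \<le> norm (A *v z + \<tau> *\<^sub>R r)"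
    using injective_imp_bounded_below[OF inj] by blast
  define t where "t = norm (b - A *v x)"
  have t: "t > 0" using ne by (simp add: t_def)
  have r: "r = (b - A *v x) /\<^sub>R t"
    using cert t unfolding certificate_def t_def
    by (metis less_numeral_extra(3) scaleR_scaleR left_inverse scaleR_one)
  define u where "u w = fst (fst w) - A *v snd w" for w :: "((real ^ 'm) \<times> real) \<times> (real ^ 'n)"
  define \<nu> where "\<nu> w = u w /\<^sub>R norm (u w)" for w
  define good where "good w \<longleftrightarrow> norm (u w) > t / 2 \<and> norm (u w) < 2 * t \<and> norm (\<nu> w - r) < k / 2 \<and>
      (\<forall>i. i \<notin> J \<longrightarrow> \<bar>column i A \<bullet> \<nu> w\<bar> < snd (fst w))" for w
  let ?w0 = "((b, lam), x)"
  have "((\<lambda>w. fst (fst w) - A *v snd w) \<longlongrightarrow> fst (fst ?w0) - A *v snd ?w0) (nhds ?w0)"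
    by (intro tendsto_diff bounded_linear.tendsto[OF matrix_vector_mul_bounded_linear]
        tendsto_fst tendsto_snd filterlim_ident)
  then have u_lim: "(u \<longlongrightarrow> b - A *v x) (nhds ?w0)" by (simp add: u_def[abs_def])
  have norm_lim: "((\<lambda>w. norm (u w)) \<longlongrightarrow> t) (nhds ?w0)"
    unfolding t_def by (intro tendsto_norm u_lim)
  have \<nu>_lim: "(\<nu> \<longlongrightarrow> r) (nhds ?w0)"
    unfolding \<nu>_def r using t by (intro tendsto_intros u_lim norm_lim) auto
  have "\<forall>\<^sub>F w in nhds ?w0. t / 2 < norm (u w)" "\<forall>\<^sub>F w in nhds ?w0. norm (u w) < 2 * t"
    using t by (intro order_tendstoD[OF norm_lim]; simp)+
  moreover have "((\<lambda>w. norm (\<nu> w - r)) \<longlongrightarrow> 0) (nhds ?w0)"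
    using \<nu>_lim by (simp add: tendsto_norm_zero_iff LIM_zero)
  then have "\<forall>\<^sub>F w in nhds ?w0. norm (\<nu> w - r) < k / 2"
    using k by (intro order_tendstoD) auto
  moreover have "\<forall>\<^sub>F w in nhds ?w0. \<forall>i. i \<notin> J \<longrightarrow> \<bar>column i A \<bullet> \<nu> w\<bar> < snd (fst w)"
  proof (rule eventually_all_finite)
    fix i
    show "\<forall>\<^sub>F w in nhds ?w0. i \<notin> J \<longrightarrow> \<bar>column i A \<bullet> \<nu> w\<bar> < snd (fst w)"
    proof (cases "i \<in> J")
      case False
      have "((\<lambda>w. snd (fst w) - \<bar>column i A \<bullet> \<nu> w\<bar>) \<longlongrightarrow> snd (fst ?w0) - \<bar>column i A \<bullet> r\<bar>) (nhds ?w0)"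
        by (intro tendsto_intros \<nu>_lim tendsto_fst tendsto_snd filterlim_ident)
      moreover have "\<bar>column i A \<bullet> r\<bar> < lam"
        using False cert unfolding J certificate_def by (simp add: order_less_le)
      ultimately have "\<forall>\<^sub>F w in nhds ?w0. 0 < snd (fst w) - \<bar>column i A \<bullet> \<nu> w\<bar>"
        by (intro order_tendstoD) auto
      then show ?thesis by eventually_elim auto
    qed simp
  qed
  ultimately have "\<forall>\<^sub>F w in nhds ?w0. good w"
    unfolding good_def by eventually_elim auto
  then have "\<forall>\<^sub>F q in nhds (b, lam). \<forall>y\<in>sr_lasso_sol A q. good (q, y)"
    by (rule sr_lasso_sol_upper_semicontinuous[OF lam injective_imp_unique[OF cert J inj]])
  moreover have "\<forall>\<^sub>F q in nhds (b, lam). q \<in> UNIV \<times> {0<..}"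
    using lam by (intro eventually_nhds_in_open open_Times) auto
  ultimately have "\<forall>\<^sub>F q in nhds (b, lam). q \<in> UNIV \<times> {0<..} \<and> (\<forall>y\<in>sr_lasso_sol A q. good (q, y))"
    by eventually_elim auto
  then obtain U where U: "open U" "(b, lam) \<in> U" "U \<subseteq> UNIV \<times> {0<..}"
    and good: "\<And>q y. q \<in> U \<Longrightarrow> y \<in> sr_lasso_sol A q \<Longrightarrow> good (q, y)"
    unfolding eventually_nhds by blast
  have cert': "certificate A (fst q) (snd q) y (\<nu> (q, y)) \<and> y \<in> coeff_space J"
    if q: "q \<in> U" and y: "y \<in> sr_lasso_sol A q" for q y
  proof -
    have g: "good (q, y)" using q y by (rule good)
    then have "A *v y \<noteq> fst q" using t by (auto simp: good_def u_def)
    then have c: "certificate A (fst q) (snd q) y (\<nu> (q, y))"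
      unfolding \<nu>_def u_def fst_conv snd_conv using q y U(3) by (intro sol_imp_certificate) auto
    moreover have "y $ i = 0" if "i \<notin> J" for i
      using certificate_support[OF c, of i] g that unfolding good_def fst_conv snd_conv
      by (metis less_irrefl)
    ultimately show ?thesis by (simp add: coeff_space_def)
  qed
  obtain L where L: "L \<ge> 0"
    and lip: "\<And>p q y z. p \<in> U \<Longrightarrow> q \<in> U \<Longrightarrow> y \<in> sr_lasso_sol A p \<Longrightarrow> z \<in> sr_lasso_sol A q \<Longrightarrow>
      norm (y - z) \<le> L * dist p q"
  proof
    let ?L = "2 / k * (1 + 2 * t * (1 + (2 / t) * (1 + real CARD('n) * (2 / k) * (1 + 2 * t))))"
    show "?L \<ge> 0" using k t by simp
    fix p q y z
    assume pq: "p \<in> U" "q \<in> U" and yz: "y \<in> sr_lasso_sol A p" "z \<in> sr_lasso_sol A q"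
    have "good (p, y)" "good (q, z)" using pq yz by (auto intro: good)
    then show "norm (y - z) \<le> ?L * dist p q"
      using certificates_lipschitz[OF k t bound conjunct1[OF cert'] conjunct1[OF cert']
          conjunct2[OF cert'] conjunct2[OF cert'], OF _ pq(1) yz(1) pq(2) yz(2) pq(1) yz(1) pq(2) yz(2)]
      by (simp add: good_def u_def)
  qed
  have single: "is_singleton (sr_lasso_sol A q)" if "q \<in> U" for q
  proof -
    have "sr_lasso_sol A q \<noteq> {}"
      using sr_lasso_sol_nonempty[of "snd q" A "fst q"] that U(3) by auto
    moreover have "y = z" if "y \<in> sr_lasso_sol A q" "z \<in> sr_lasso_sol A q" for y z
      using lip[OF \<open>q \<in> U\<close> \<open>q \<in> U\<close> that] by simp
    ultimately show ?thesis by (metis is_singletonI')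
  qed
  then have "the_elem (sr_lasso_sol A q) \<in> sr_lasso_sol A q" if "q \<in> U" for q
    using that by (metis is_singleton_the_elem singletonI)
  then have "L-lipschitz_on U (\<lambda>q. the_elem (sr_lasso_sol A q))"
    using lip L by (intro lipschitz_onI) (auto simp: dist_norm)
  then show ?thesis
    unfolding locally_single_valued_lipschitz_def using U single by blast
qed

section \<open>The characterization\<close>

theorem theorem5p3:
  fixes A :: "real ^ 'n ^ 'm" and b :: "real ^ 'm" and lam :: real
  assumes "lam > 0"
    and "(\<lambda>x. A *v x) ` sr_lasso_sol A (b, lam) \<noteq> {b}"
  shows "locally_single_valued_lipschitz (UNIV \<times> {0<..}) (sr_lasso_sol A) (b, lam) \<longleftrightarrow>
    (\<exists>x \<in> sr_lasso_sol A (b, lam). A *v x \<noteq> b \<and>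
       submatrix_ker A (J_SR A b lam x) = {0} \<and>
       b \<notin> submatrix_rge A (J_SR A b lam x))"
proof
  assume "locally_single_valued_lipschitz (UNIV \<times> {0<..}) (sr_lasso_sol A) (b, lam)"
  then obtain U where U: "open U" "(b, lam) \<in> U" "\<And>q. q \<in> U \<Longrightarrow> is_singleton (sr_lasso_sol A q)"
    unfolding locally_single_valued_lipschitz_def by blast
  obtain x where x: "x \<in> sr_lasso_sol A (b, lam)" "A *v x \<noteq> b"
    using sr_lasso_sol_nonempty[OF assms(1), of A b] assms(2) by blast
  note cert = sol_imp_certificate[OF assms(1) x]
  have "((\<lambda>b'. (b', lam)) \<longlongrightarrow> (b, lam)) (nhds b)"
    by (intro tendsto_Pair filterlim_ident tendsto_const)
  then have "\<forall>\<^sub>F b' in nhds b. is_singleton (sr_lasso_sol A (b', lam))"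
    using eventually_compose_filterlim[OF eventually_nhds_in_open[OF U(1,2)]] U(3)
    by (blast intro: eventually_mono)
  from single_valued_imp_injective[OF assms(1) cert x(2) this]
  have "submatrix_ker A (J_SR A b lam x) = {0} \<and> b \<notin> submatrix_rge A (J_SR A b lam x)"
    unfolding submatrix_conditions_iff[OF cert x(2) J_SR_eq] unfolding J_SR_eq by blast
  with x show "\<exists>x \<in> sr_lasso_sol A (b, lam). A *v x \<noteq> b \<and>
       submatrix_ker A (J_SR A b lam x) = {0} \<and> b \<notin> submatrix_rge A (J_SR A b lam x)"
    by blast
next
  assume "\<exists>x \<in> sr_lasso_sol A (b, lam). A *v x \<noteq> b \<and>
       submatrix_ker A (J_SR A b lam x) = {0} \<and> b \<notin> submatrix_rge A (J_SR A b lam x)"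
  then obtain x where x: "x \<in> sr_lasso_sol A (b, lam)" "A *v x \<noteq> b"
    and cond: "submatrix_ker A (J_SR A b lam x) = {0} \<and> b \<notin> submatrix_rge A (J_SR A b lam x)"
    by blast
  note cert = sol_imp_certificate[OF assms(1) x]
  show "locally_single_valued_lipschitz (UNIV \<times> {0<..}) (sr_lasso_sol A) (b, lam)"
    using injective_imp_locally_lipschitz[OF assms(1) cert x(2) J_SR_eq]
      cond[unfolded submatrix_conditions_iff[OF cert x(2) J_SR_eq]] by blast
qed

end
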